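(* Let $r\in\mathbb N$ and let $\mathbb N=C_1\cup\dots\cup C_r$ be a finite colouring. Then there are $m\le r$ and an increasing sequence $(x_i)_{i\in\mathbb N}$ of natural numbers such that, for all $k<\ell$ in $\mathbb N$ and all indices $i_1<\dots<i_\ell$ in $\mathbb N$, the colour $C_m$ contains $$x_{i_1}+\dots+x_{i_k}\qquad\text{and}\qquad \frac{x_{i_{k+1}}+\dots+x_{i_\ell}}{x_{i_1}+\dots+x_{i_k}}.$$ (In particular, each of these quotients is a natural number.)
   Context: $\mathbb N$ denotes the set of positive integers ($0\notin\mathbb N$). A finite colouring of $\mathbb N$ is a partition of $\mathbb N$ into finitely many pieces $C_1,\dots,C_r$, called colours. *)

theory Defs
  imports Complex_Main "HOL-Library.Disjoint_Sets"
begin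

(* The positive integers are the subset {1..} of nat; colours and indices start at 1.
   As usual for colourings, a colour class is allowed to be empty. *)
definition finite_colouring :: "nat \<Rightarrow> (nat \<Rightarrow> nat set) \<Rightarrow> bool" where
  "finite_colouring r C \<longleftrightarrow>
     (\<Union>c\<in>{1..r}. C c) = {1..} \<and> disjoint_family_on C {1..r}"

end

theory Submission
  imports Defs
begin

text \<open>
  Let \<open>u\<close> be an idempotent ultrafilter of the additive semigroup of positive integers. It
  contains every set of multiples, so \<open>y/x\<close> is an integer for \<open>u\<close>-almost all \<open>x\<close> and then
  \<open>u\<close>-almost all \<open>y\<close>, and by pigeonhole these quotients have one colour \<open>m\<close>. As in the
  ultrafilter proofs of the theorems of Hindman and Milliken--Taylor, idempotence yields an
  increasing sequence \<open>b\<^sub>0, b\<^sub>1, \<dots>\<close> with \<open>b\<^sub>G/b\<^sub>F \<in> C\<^sub>m\<close> for all finite sets of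
  indices \<open>F < G\<close>, where \<open>b\<^sub>F\<close> denotes the sum of the \<open>b\<^sub>i\<close> with \<open>i \<in> F\<close>. Since
  \<open>b\<^sub>0\<close> divides all later terms, \<open>x\<^sub>i = b\<^sub>i/b\<^sub>0\<close> is a sequence of integers. It has the same
  quotients as \<open>b\<close>, and its sums \<open>b\<^sub>F/b\<^sub>0\<close> are such quotients too.
\<close>

section \<open>Idempotent ultrafilters\<close>

definition is_ultrafilter :: "'a filter \<Rightarrow> bool" where
  "is_ultrafilter F \<longleftrightarrow> F \<noteq> bot \<and> (\<forall>P. eventually P F \<or> eventually (\<lambda>x. \<not> P x) F)"

lemma is_ultrafilter_not_eventually:
  assumes "is_ultrafilter F"
  shows "\<not> eventually P F \<longleftrightarrow> eventually (\<lambda>x. \<not> P x) F"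
proof
  assume "\<not> eventually P F"
  then show "eventually (\<lambda>x. \<not> P x) F"
    using assms by (auto simp: is_ultrafilter_def)
next
  assume "eventually (\<lambda>x. \<not> P x) F"
  moreover have "F \<noteq> bot"
    using assms by (simp add: is_ultrafilter_def)
  ultimately show "\<not> eventually P F"
    using eventually_conj[of P F "\<lambda>x. \<not> P x"] by (auto simp: trivial_limit_def)
qed

lemma is_ultrafilter_pigeonhole:
  assumes "is_ultrafilter F" "finite I" "eventually (\<lambda>x. \<exists>i\<in>I. P i x) F"
  shows "\<exists>i\<in>I. eventually (P i) F"
proof (rule ccontr)
  assume "\<not> ?thesis"
  then have "\<forall>i\<in>I. eventually (\<lambda>x. \<not> P i x) F"
    using is_ultrafilter_not_eventually[OF assms(1)] by blast
  then have "eventually (\<lambda>x. \<forall>i\<in>I. \<not> P i x) F"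
    using \<open>finite I\<close> by (simp add: eventually_ball_finite)
  then have "\<not> eventually (\<lambda>x. \<not> (\<forall>i\<in>I. \<not> P i x)) F"
    using is_ultrafilter_not_eventually[OF assms(1)] by blast
  then show False
    using assms(3) by simp
qed

text \<open>Zorn's lemma for the reversed order. The empty chain is bounded by \<open>F\<close>
  itself, so only nonempty chains need an infimum satisfying \<open>P\<close>.\<close>

lemma minimal_filter_exists:
  fixes P :: "'a filter \<Rightarrow> bool"
  assumes "P F"
    and chain: "\<And>\<C>. \<lbrakk>\<C> \<noteq> {}; \<And>G H. \<lbrakk>G \<in> \<C>; H \<in> \<C>\<rbrakk> \<Longrightarrow> G \<le> H \<or> H \<le> G; \<And>G. G \<in> \<C> \<Longrightarrow> P G\<rbrakk>
      \<Longrightarrow> P (Inf \<C>)"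
  obtains M where "M \<le> F" "P M" "\<And>G. \<lbrakk>P G; G \<le> M\<rbrakk> \<Longrightarrow> G = M"
proof -
  let ?A = "{G. P G \<and> G \<le> F}"
  have "\<exists>M\<in>?A. \<forall>G\<in>?A. G \<le> M \<longrightarrow> G = M"
  proof (rule predicate_Zorn[where P = "\<lambda>G H. H \<le> G"])
    show "partial_order_on ?A (relation_of (\<lambda>G H. H \<le> G) ?A)"
      by (auto simp: partial_order_on_def preorder_on_def refl_on_def trans_def antisym_def
          relation_of_def)
  next
    fix \<C> assume \<C>: "\<C> \<in> Chains (relation_of (\<lambda>G H. H \<le> G) ?A)"
    then have sub: "\<C> \<subseteq> ?A"
      and tot: "\<And>G H. \<lbrakk>G \<in> \<C>; H \<in> \<C>\<rbrakk> \<Longrightarrow> G \<le> H \<or> H \<le> G"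
      unfolding Chains_def relation_of_def by blast+
    show "\<exists>u\<in>?A. \<forall>G\<in>\<C>. u \<le> G"
    proof (cases "\<C> = {}")
      case True
      then show ?thesis using \<open>P F\<close> by auto
    next
      case False
      then obtain G where "G \<in> \<C>" by blast
      then have "Inf \<C> \<le> F"
        using sub by (auto intro: Inf_lower2)
      moreover have "P (Inf \<C>)"
        using False tot sub by (intro chain) auto
      ultimately show ?thesis
        by (auto intro: Inf_lower)
    qed
  qed
  then obtain M where "P M" "M \<le> F" "\<forall>G\<in>?A. G \<le> M \<longrightarrow> G = M"
    by blast
  then show thesis
    by (intro that[of M]) (auto intro: order_trans)
qed

text \<open>A chain is directed downwards, so nothing beyond its members is needed to generate the
  infimum; in particular, the infimum of a nonempty chain of proper filters is proper.\<close>

lemma eventually_Inf_chain: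
  assumes "\<C> \<noteq> {}" "\<And>G H. \<lbrakk>G \<in> \<C>; H \<in> \<C>\<rbrakk> \<Longrightarrow> G \<le> H \<or> H \<le> G"
  shows "eventually P (Inf \<C>) \<longleftrightarrow> (\<exists>G\<in>\<C>. eventually P G)"
proof (rule eventually_Inf_base[OF assms(1)])
  fix G H assume "G \<in> \<C>" "H \<in> \<C>"
  then show "\<exists>K\<in>\<C>. K \<le> inf G H"
    using assms(2)[of G H] by (auto intro: le_infI)
qed

text \<open>A minimal proper filter decides every predicate: if the negation of \<open>P\<close> is
  not large, restricting the filter to \<open>P\<close> keeps it proper and hence changes
  nothing.\<close>

lemma ultrafilter_exists:
  assumes "F \<noteq> bot"
  obtains U where "U \<le> F" "is_ultrafilter U"
proof (rule minimal_filter_exists[of "\<lambda>G. G \<noteq> bot" F])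
  show "F \<noteq> bot" by fact
  show "Inf \<C> \<noteq> bot"
    if "\<C> \<noteq> {}" "\<And>G H. \<lbrakk>G \<in> \<C>; H \<in> \<C>\<rbrakk> \<Longrightarrow> G \<le> H \<or> H \<le> G" "\<And>G. G \<in> \<C> \<Longrightarrow> G \<noteq> bot"
    for \<C> :: "'a filter set"
    unfolding trivial_limit_def
    by (subst eventually_Inf_chain) (use that in \<open>auto simp: trivial_limit_def\<close>)
next
  fix M assume M: "M \<le> F" "M \<noteq> bot" and min: "\<And>G. \<lbrakk>G \<noteq> bot; G \<le> M\<rbrakk> \<Longrightarrow> G = M"
  have "eventually P M \<or> eventually (\<lambda>x. \<not> P x) M" for P
  proof (rule disjCI)
    assume "\<not> eventually (\<lambda>x. \<not> P x) M"
    then have "inf M (principal {x. P x}) \<noteq> bot"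
      by (simp add: trivial_limit_def eventually_inf_principal)
    then have "inf M (principal {x. P x}) = M"
      by (rule min) simp
    then show "eventually P M"
      using eventually_inf_principal[of P M "{x. P x}"] by simp
  qed
  with M show thesis
    by (intro that) (auto simp: is_ultrafilter_def)
qed

text \<open>On ultrafilters this is the addition of the Stone-Cech compactification, with the
  convention that makes it continuous in the left argument.\<close>

definition filter_add :: "'a::semigroup_add filter \<Rightarrow> 'a filter \<Rightarrow> 'a filter" where
  "filter_add F G = Abs_filter (\<lambda>P. \<forall>\<^sub>F x in F. \<forall>\<^sub>F y in G. P (x + y))"

lemma eventually_filter_add:
  "eventually P (filter_add F G) \<longleftrightarrow> (\<forall>\<^sub>F x in F. \<forall>\<^sub>F y in G. P (x + y))"
  unfolding filter_add_def
proof (rule eventually_Abs_filter, rule is_filter.intro)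
  fix P Q
  assume "\<forall>\<^sub>F x in F. \<forall>\<^sub>F y in G. P (x + y)" "\<forall>\<^sub>F x in F. \<forall>\<^sub>F y in G. Q (x + y)"
  then show "\<forall>\<^sub>F x in F. \<forall>\<^sub>F y in G. P (x + y) \<and> Q (x + y)"
    by eventually_elim (rule eventually_conj)
next
  fix P Q :: "'a \<Rightarrow> bool"
  assume "\<forall>x. P x \<longrightarrow> Q x" "\<forall>\<^sub>F x in F. \<forall>\<^sub>F y in G. P (x + y)"
  then show "\<forall>\<^sub>F x in F. \<forall>\<^sub>F y in G. Q (x + y)"
    by (auto elim!: eventually_mono)
qed simp

lemma filter_add_assoc: "filter_add (filter_add F G) H = filter_add F (filter_add G H)"
  by (rule filter_eqI) (simp add: eventually_filter_add add.assoc)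

lemma filter_add_mono:
  assumes "F \<le> F'" "G \<le> G'"
  shows "filter_add F G \<le> filter_add F' G'"
  unfolding le_filter_def eventually_filter_add
  using assms by (auto elim!: eventually_mono filter_leD)

lemma filter_add_eq_bot_iff: "filter_add F G = bot \<longleftrightarrow> F = bot \<or> G = bot"
  by (cases "G = bot") (simp_all add: trivial_limit_def eventually_filter_add)

text \<open>
  A filter \<open>F\<close> corresponds to the closed set of the ultrafilters below it, and
  \<open>filter_add F F \<le> F\<close> makes this set a subsemigroup of the Stone-Cech compactification.
  The proof thus follows the Ellis--Numakura theorem, with minimal filters in place of
  minimal closed subsemigroups.
\<close>

lemma idempotent_ultrafilter_exists:
  fixes F :: "'a::semigroup_add filter"
  assumes "F \<noteq> bot" "filter_add F F \<le> F"
  obtains U where "U \<le> F" "is_ultrafilter U" "filter_add U U \<le> U"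
proof (rule minimal_filter_exists[of "\<lambda>G. G \<noteq> bot \<and> filter_add G G \<le> G" F])
  show "F \<noteq> bot \<and> filter_add F F \<le> F" using assms by simp
  fix \<C> :: "'a filter set"
  assume ne: "\<C> \<noteq> {}" and tot: "\<And>G H. \<lbrakk>G \<in> \<C>; H \<in> \<C>\<rbrakk> \<Longrightarrow> G \<le> H \<or> H \<le> G"
    and \<C>: "\<And>G. G \<in> \<C> \<Longrightarrow> G \<noteq> bot \<and> filter_add G G \<le> G"
  have "Inf \<C> \<noteq> bot"
    unfolding trivial_limit_def
    by (subst eventually_Inf_chain) (use ne tot \<C> in \<open>auto simp: trivial_limit_def\<close>)
  moreover have "filter_add (Inf \<C>) (Inf \<C>) \<le> G" if "G \<in> \<C>" for G
    using filter_add_mono[of "Inf \<C>" G "Inf \<C>" G] \<C>[OF that] that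
    by (auto intro: Inf_lower order_trans)
  ultimately show "Inf \<C> \<noteq> bot \<and> filter_add (Inf \<C>) (Inf \<C>) \<le> Inf \<C>"
    by (auto intro: Inf_greatest)
next
  fix M
  assume "M \<le> F" and M: "M \<noteq> bot \<and> filter_add M M \<le> M"
    and min: "\<And>G. \<lbrakk>G \<noteq> bot \<and> filter_add G G \<le> G; G \<le> M\<rbrakk> \<Longrightarrow> G = M"
  from M obtain p where p: "p \<le> M" "is_ultrafilter p"
    using ultrafilter_exists by blast
  \<comment> \<open>\<open>filter_add M p\<close> stands for the translate by \<open>p\<close> of
    the minimal subsemigroup. This is a subsemigroup inside the minimal one, hence all of
    it.\<close>
  have "filter_add M p = M"
  proof (rule min)
    have "filter_add (filter_add M p) (filter_add M p) = filter_add M (filter_add p (filter_add M p))"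
      by (rule filter_add_assoc)
    also have "\<dots> \<le> filter_add M (filter_add M (filter_add M p))"
      using p by (intro filter_add_mono order_refl)
    also have "\<dots> = filter_add (filter_add (filter_add M M) M) p"
      by (simp add: filter_add_assoc)
    also have "\<dots> \<le> filter_add (filter_add M M) p"
      using M by (intro filter_add_mono order_refl) auto
    also have "\<dots> \<le> filter_add M p"
      using M by (intro filter_add_mono order_refl) auto
    finally show "filter_add M p \<noteq> bot \<and> filter_add (filter_add M p) (filter_add M p) \<le> filter_add M p"
      using M p by (simp add: filter_add_eq_bot_iff is_ultrafilter_def)
    have "filter_add M p \<le> filter_add M M"
      using p by (intro filter_add_mono order_refl)
    then show "filter_add M p \<le> M"
      using M by (auto intro: order_trans)
  qed
  then have Mp: "(\<forall>\<^sub>F x in M. \<forall>\<^sub>F y in p. P (x + y)) \<longleftrightarrow> eventually P M" for P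
    by (metis eventually_filter_add)
  \<comment> \<open>the filter of the stabiliser \<open>{q. q + p = p}\<close> inside \<open>M\<close>\<close>
  define S where "S = Abs_filter (\<lambda>P. \<exists>A. eventually A p \<and>
    (\<forall>\<^sub>F x in M. (\<forall>\<^sub>F y in p. A (x + y)) \<longrightarrow> P x))"
  have S: "eventually P S \<longleftrightarrow>
      (\<exists>A. eventually A p \<and> (\<forall>\<^sub>F x in M. (\<forall>\<^sub>F y in p. A (x + y)) \<longrightarrow> P x))" for P
    unfolding S_def
  proof (rule eventually_Abs_filter, rule is_filter.intro)
    show "\<exists>A. eventually A p \<and> (\<forall>\<^sub>F x in M. (\<forall>\<^sub>F y in p. A (x + y)) \<longrightarrow> True)"
      by (intro exI[of _ "\<lambda>_. True"]) simp
  next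
    fix P Q
    assume "\<exists>A. eventually A p \<and> (\<forall>\<^sub>F x in M. (\<forall>\<^sub>F y in p. A (x + y)) \<longrightarrow> P x)"
      and "\<exists>A. eventually A p \<and> (\<forall>\<^sub>F x in M. (\<forall>\<^sub>F y in p. A (x + y)) \<longrightarrow> Q x)"
    then obtain A B where A: "eventually A p" "\<forall>\<^sub>F x in M. (\<forall>\<^sub>F y in p. A (x + y)) \<longrightarrow> P x"
      and B: "eventually B p" "\<forall>\<^sub>F x in M. (\<forall>\<^sub>F y in p. B (x + y)) \<longrightarrow> Q x"
      by blast
    have "\<forall>\<^sub>F x in M. (\<forall>\<^sub>F y in p. A (x + y) \<and> B (x + y)) \<longrightarrow> P x \<and> Q x"
      using A(2) B(2) by eventually_elim (simp add: eventually_conj_iff)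
    with A B show "\<exists>A. eventually A p \<and> (\<forall>\<^sub>F x in M. (\<forall>\<^sub>F y in p. A (x + y)) \<longrightarrow> P x \<and> Q x)"
      by (intro exI[of _ "\<lambda>x. A x \<and> B x"]) (simp add: eventually_conj_iff)
  next
    fix P Q :: "'a \<Rightarrow> bool"
    assume "\<forall>x. P x \<longrightarrow> Q x" "\<exists>A. eventually A p \<and> (\<forall>\<^sub>F x in M. (\<forall>\<^sub>F y in p. A (x + y)) \<longrightarrow> P x)"
    then show "\<exists>A. eventually A p \<and> (\<forall>\<^sub>F x in M. (\<forall>\<^sub>F y in p. A (x + y)) \<longrightarrow> Q x)"
      by (elim exE conjE, intro exI conjI) (assumption, auto elim: eventually_mono)
  qed
  \<comment> \<open>The stabiliser is a nonempty closed subsemigroup, so minimality makes it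
    everything.\<close>
  have "S = M"
  proof (rule min, intro conjI)
    show "S \<noteq> bot"
    proof
      assume "S = bot"
      then obtain A where A: "eventually A p" "\<forall>\<^sub>F x in M. \<not> (\<forall>\<^sub>F y in p. A (x + y))"
        using S[of "\<lambda>_. False"] by auto
      \<comment> \<open>As \<open>p\<close> is an ultrafilter, the negation of
        \<open>A (x + y)\<close> holds for \<open>M\<close>-almost all \<open>x\<close> and then
        \<open>p\<close>-almost all \<open>y\<close>; \<open>filter_add M p = M\<close> turns this
        into a statement about \<open>M\<close> alone.\<close>
      then have "eventually (\<lambda>x. \<not> A x) M"
        using Mp[of "\<lambda>x. \<not> A x"] is_ultrafilter_not_eventually[OF p(2)] by simp
      then have "eventually (\<lambda>x. \<not> A x) p"
        using p(1) by (rule filter_leD[rotated])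
      with A(1) show False
        using is_ultrafilter_not_eventually[OF p(2)] by blast
    qed
    show "S \<le> M"
      unfolding le_filter_def S by (auto intro!: exI[of _ "\<lambda>_. True"] elim: eventually_mono)
    show "filter_add S S \<le> S"
    proof (rule filter_leI)
      fix P assume "eventually P S"
      then obtain A where A: "eventually A p" "\<forall>\<^sub>F x in M. (\<forall>\<^sub>F y in p. A (x + y)) \<longrightarrow> P x"
        using S by blast
      \<comment> \<open>For almost every \<open>x\<close> the implication holds at
        \<open>x + y\<close> for almost all \<open>y\<close>. If such an \<open>x\<close> satisfies
        the premise, then \<open>\<lambda>w. A (x + w)\<close> is large for \<open>p\<close> and is
        the witness for the translate of \<open>P\<close> by \<open>x\<close>.\<close>
      have "eventually (\<lambda>x. (\<forall>\<^sub>F y in p. A (x + y)) \<longrightarrow> P x) (filter_add M M)"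
        using M A(2) by (blast intro: filter_leD)
      then have "\<forall>\<^sub>F x in M. (\<forall>\<^sub>F y in p. A (x + y)) \<longrightarrow> (\<forall>\<^sub>F y in S. P (x + y))"
        unfolding eventually_filter_add
      proof eventually_elim
        case (elim x)
        then show ?case
          unfolding S by (intro impI exI[of _ "\<lambda>w. A (x + w)"]) (simp add: add.assoc)
      qed
      with A(1) show "eventually P (filter_add S S)"
        unfolding eventually_filter_add S[of "\<lambda>x. \<forall>\<^sub>F y in S. P (x + y)"] by blast
    qed
  qed
  \<comment> \<open>Now all of \<open>M\<close> stabilises \<open>p\<close>: a
    \<open>p\<close>-large \<open>A\<close> is large for \<open>filter_add M p\<close>, which is
    \<open>M\<close>. Hence \<open>M\<close> is the ultrafilter \<open>p\<close>.\<close>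
  have "M \<le> p"
  proof (rule filter_leI)
    fix A assume "eventually A p"
    then have "\<forall>\<^sub>F x in S. \<forall>\<^sub>F y in p. A (x + y)"
      unfolding S by (intro exI[of _ A]) simp
    then show "eventually A M"
      unfolding \<open>S = M\<close> Mp .
  qed
  with p have "is_ultrafilter M"
    by (simp add: antisym)
  with \<open>M \<le> F\<close> M show thesis
    by (intro that) auto
qed

section \<open>Idempotent ultrafilters on the natural numbers\<close>

lemma idempotent_ultrafilter_nat_exists:
  obtains U :: "nat filter" where "U \<le> sequentially" "is_ultrafilter U" "filter_add U U \<le> U"
proof (rule idempotent_ultrafilter_exists)
  \<comment> \<open>Staying below \<open>sequentially\<close> rules out the principal idempotent at
    0 and lets the terms chosen later exceed any bound.\<close>
  show "filter_add sequentially sequentially \<le> (sequentially :: nat filter)"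
    unfolding le_filter_def eventually_filter_add eventually_sequentially
    by (auto intro: trans_le_add1)
qed auto

text \<open>By pigeonhole almost all elements share a residue \<open>s\<close>; idempotence makes
  \<open>s + s\<close> congruent to \<open>s\<close> modulo \<open>n\<close>, so
  \<open>s = 0\<close>.\<close>

lemma idempotent_ultrafilter_nat_dvd:
  fixes U :: "nat filter"
  assumes U: "is_ultrafilter U" "filter_add U U \<le> U" and "n > 0"
  shows "eventually (\<lambda>y. n dvd y) U"
proof -
  have "\<forall>\<^sub>F y in U. \<exists>s\<in>{..<n}. y mod n = s"
    using \<open>n > 0\<close> by simp
  then obtain s where s: "\<forall>\<^sub>F y in U. y mod n = s"
    using is_ultrafilter_pigeonhole[OF U(1), of "{..<n}" "\<lambda>s y. y mod n = s"] by auto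
  have "\<forall>\<^sub>F x in U. \<forall>\<^sub>F y in U. (x + y) mod n = s"
    using filter_leD[OF U(2) s] by (simp add: eventually_filter_add)
  with s have "\<forall>\<^sub>F x in U. x mod n = s \<and> (\<forall>\<^sub>F y in U. y mod n = s \<and> (x + y) mod n = s)"
    by (simp add: eventually_conj_iff)
  moreover have "U \<noteq> bot"
    using U by (simp add: is_ultrafilter_def)
  ultimately obtain x where "x mod n = s" "\<forall>\<^sub>F y in U. y mod n = s \<and> (x + y) mod n = s"
    using eventually_happens by blast
  moreover obtain y where "y mod n = s" "(x + y) mod n = s"
    using eventually_happens[OF calculation(2)] \<open>U \<noteq> bot\<close> by blast
  ultimately have "(x + y) mod n = x mod n"
    by simp
  then have "n dvd y"
    by (simp add: mod_eq_dvd_iff_nat)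
  with \<open>y mod n = s\<close> have "s = 0"
    by simp
  with s show ?thesis
    by (simp add: dvd_eq_mod_eq_0)
qed

section \<open>Sequences with monochromatic quotients\<close>

lemma eventually_star:
  assumes "filter_add U U \<le> U" "eventually P U"
  shows "\<forall>\<^sub>F x in U. P x \<and> (\<forall>\<^sub>F y in U. P (x + y))"
  using filter_leD[OF assms] assms(2) by (simp add: eventually_filter_add eventually_conj_iff)

text \<open>Apply \<open>eventually_star\<close> to the translate of \<open>P\<close> by
  \<open>x\<close>. In Hindman's notation: for x in A^*, the set A^* - x is again large.\<close>

lemma star_eventually_star:
  fixes x :: "'a::semigroup_add"
  assumes "filter_add U U \<le> U" "\<forall>\<^sub>F y in U. P (x + y)"
  shows "\<forall>\<^sub>F y in U. P (x + y) \<and> (\<forall>\<^sub>F z in U. P (x + y + z))"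
  using eventually_star[OF assms] by (simp add: add.assoc)

text \<open>
  The induction maintains \<open>P x \<and> (\<forall>\<^sub>F y in U. P (x + y))\<close>, written \<open>star P x\<close>, for the
  relevant predicates \<open>P\<close> and sums \<open>x\<close>: by \<open>star_eventually_star\<close> this stronger property is
  preserved by adding almost any further element.
\<close>

lemma milliken_taylor_pairs:
  fixes U :: "nat filter" and Q :: "nat \<Rightarrow> nat \<Rightarrow> bool"
  assumes U: "U \<noteq> bot" "U \<le> sequentially" "filter_add U U \<le> U"
    and Q: "\<forall>\<^sub>F x in U. \<forall>\<^sub>F y in U. Q x y"
  obtains b :: "nat \<Rightarrow> nat" where "strict_mono b"
    "\<And>F G. \<lbrakk>finite F; finite G; F \<noteq> {}; G \<noteq> {}; \<forall>i\<in>F. \<forall>j\<in>G. i < j\<rbrakk> \<Longrightarrow> Q (sum b F) (sum b G)"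
proof -
  define star :: "(nat \<Rightarrow> bool) \<Rightarrow> nat \<Rightarrow> bool"
    where "star = (\<lambda>P x. P x \<and> (\<forall>\<^sub>F y in U. P (x + y)))"
  have ev_star: "eventually (star P) U" if "eventually P U" for P
    using eventually_star[OF U(3) that] by (simp add: star_def)
  have star_ev: "\<forall>\<^sub>F y in U. star P (x + y)" if "star P x" for P x
    using star_eventually_star[OF U(3), of P x] that by (simp add: star_def)
  \<comment> \<open>\<open>D x\<close> makes \<open>x\<close> admissible as a left block: almost
    every \<open>y\<close> may follow it.\<close>
  define D where "D = (\<lambda>x. \<forall>\<^sub>F y in U. Q x y)"
  \<comment> \<open>\<open>ok f n r\<close> admits \<open>r\<close> as term number \<open>n\<close>
    after the earlier terms of \<open>f\<close>. The empty \<open>F\<close> in the \<open>D\<close>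
    clause and the empty \<open>G\<close> in the \<open>Q\<close> clause cover blocks consisting of
    \<open>r\<close> alone.\<close>
  define ok :: "(nat \<Rightarrow> nat) \<Rightarrow> nat \<Rightarrow> nat \<Rightarrow> bool" where
    "ok = (\<lambda>f n r. (\<forall>i<n. f i < r) \<and> (\<forall>F\<in>Pow {..<n}. star D (sum f F + r)) \<and>
      (\<forall>F\<in>Pow {..<n}. \<forall>G\<in>Pow {..<n}. F \<noteq> {} \<longrightarrow> (\<forall>i\<in>F. \<forall>j\<in>G. i < j) \<longrightarrow>
        star (Q (sum f F)) (sum f G + r)))"
  \<comment> \<open>Once the largest index of a block is split off, \<open>ok\<close> at that index
    controls the sum over the whole block.\<close>
  have split: "\<exists>n H'. n \<in> H \<and> H = insert n H' \<and> H' \<subseteq> {..<n} \<and> (\<forall>f::nat\<Rightarrow>nat. sum f H = sum f H' + f n)"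
    if "finite H" "H \<noteq> {}" for H :: "nat set"
  proof -
    have "Max H \<in> H"
      using that by (rule Max_in)
    moreover have "H - {Max H} \<subseteq> {..<Max H}"
      using that by (auto simp: less_le)
    moreover have "H = insert (Max H) (H - {Max H})"
      using \<open>Max H \<in> H\<close> by blast
    moreover have "sum f H = sum f (H - {Max H}) + f (Max H)" for f :: "nat \<Rightarrow> nat"
      using sum.remove[OF \<open>finite H\<close> \<open>Max H \<in> H\<close>, of f] by simp
    ultimately show ?thesis
      by blast
  qed
  have starD: "star D (sum f H)"
    if "finite H" "H \<noteq> {}" and ok: "\<And>n. n \<in> H \<Longrightarrow> ok f n (f n)" for f H
  proof -
    obtain n H' where n: "n \<in> H" "H' \<subseteq> {..<n}" "sum f H = sum f H' + f n"
      using split[OF \<open>finite H\<close> \<open>H \<noteq> {}\<close>] by blast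
    then show ?thesis
      using ok[OF n(1)] unfolding ok_def by auto
  qed
  have starQ: "star (Q (sum f F)) (sum f G)"
    if "F \<noteq> {}" "finite G" "G \<noteq> {}" and less: "\<forall>i\<in>F. \<forall>j\<in>G. i < j"
      and ok: "\<And>n. n \<in> G \<Longrightarrow> ok f n (f n)" for f F G
  proof -
    obtain n G' where n: "n \<in> G" "G = insert n G'" "G' \<subseteq> {..<n}" "sum f G = sum f G' + f n"
      using split[OF \<open>finite G\<close> \<open>G \<noteq> {}\<close>] by blast
    moreover have "F \<subseteq> {..<n}"
      using less n(1) by auto
    ultimately show ?thesis
      using ok[OF n(1)] \<open>F \<noteq> {}\<close> less unfolding ok_def by auto
  qed
  have "\<exists>b. \<forall>n. ok b n (b n)"
  proof (rule dependent_wellorder_choice)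
    fix r n :: nat and f g :: "nat \<Rightarrow> nat"
    assume eq: "\<And>i. i < n \<Longrightarrow> f i = g i"
    then have "sum f F = sum g F" if "F \<in> Pow {..<n}" for F
      using that by (intro sum.cong) auto
    with eq show "ok f n r = ok g n r"
      unfolding ok_def by (simp cong: ball_cong_simp)
  next
    fix n :: nat and f :: "nat \<Rightarrow> nat"
    assume ok: "\<And>i. i < n \<Longrightarrow> ok f i (f i)"
    have 1: "\<forall>\<^sub>F r in U. star D (sum f F + r)" if F: "F \<subseteq> {..<n}" for F
    proof (cases "F = {}")
      case True
      then show ?thesis
        using ev_star Q by (simp add: D_def)
    next
      case False
      then show ?thesis
        using F ok by (intro star_ev starD) (auto intro: finite_subset)
    qed
    have 2: "\<forall>\<^sub>F r in U. star (Q (sum f F)) (sum f G + r)"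
      if F: "F \<subseteq> {..<n}" "F \<noteq> {}" and G: "G \<subseteq> {..<n}" and less: "\<forall>i\<in>F. \<forall>j\<in>G. i < j" for F G
    proof (cases "G = {}")
      case True
      \<comment> \<open>Here \<open>r\<close> opens a new right block, so there is no earlier
        \<open>Q\<close> property to extend; it comes from \<open>F\<close> being an admissible left
        block.\<close>
      have "star D (sum f F)"
        using F ok by (intro starD) (auto intro: finite_subset)
      then show ?thesis
        using True ev_star by (simp add: star_def D_def)
    next
      case False
      then show ?thesis
        using F G less ok by (intro star_ev starQ) (auto intro: finite_subset)
    qed
    have 3: "\<forall>\<^sub>F r in U. f i < r" for i
      using U(2) eventually_gt_at_top by (blast intro: filter_leD)
    have "\<forall>\<^sub>F r in U. \<forall>i\<in>{..<n}. f i < r"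
      using 3 by (intro eventually_ball_finite) auto
    moreover have "\<forall>\<^sub>F r in U. \<forall>F\<in>Pow {..<n}. star D (sum f F + r)"
      using 1 by (intro eventually_ball_finite) auto
    moreover have "\<forall>\<^sub>F r in U. \<forall>F\<in>Pow {..<n}. \<forall>G\<in>Pow {..<n}. F \<noteq> {} \<longrightarrow>
        (\<forall>i\<in>F. \<forall>j\<in>G. i < j) \<longrightarrow> star (Q (sum f F)) (sum f G + r)"
    proof (intro eventually_ball_finite ballI)
      fix F G assume "F \<in> Pow {..<n}" "G \<in> Pow {..<n}"
      then show "\<forall>\<^sub>F r in U. F \<noteq> {} \<longrightarrow> (\<forall>i\<in>F. \<forall>j\<in>G. i < j) \<longrightarrow>
          star (Q (sum f F)) (sum f G + r)"
        using 2[of F G] by (cases "F \<noteq> {} \<and> (\<forall>i\<in>F. \<forall>j\<in>G. i < j)") auto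
    qed auto
    ultimately have "\<forall>\<^sub>F r in U. ok f n r"
      by eventually_elim (simp add: ok_def)
    then show "\<exists>r. ok f n r"
      using U(1) eventually_happens by blast
  qed
  then obtain b where b: "\<And>n. ok b n (b n)"
    by blast
  show thesis
  proof (rule that)
    show "strict_mono b"
      using b by (auto simp: ok_def strict_mono_def)
    show "Q (sum b F) (sum b G)"
      if "finite F" "finite G" "F \<noteq> {}" "G \<noteq> {}" "\<forall>i\<in>F. \<forall>j\<in>G. i < j" for F G
      using starQ[of F G b] that b by (simp add: star_def)
  qed
qed

section \<open>Quotients of a single colour\<close>

lemma monochromatic_quotients:
  fixes C :: "'c \<Rightarrow> nat set"
  assumes "finite I" and cover: "{1..} \<subseteq> (\<Union>c\<in>I. C c)"
  obtains m and b :: "nat \<Rightarrow> nat" where "m \<in> I" "strict_mono b"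
    "\<And>F G. \<lbrakk>finite F; finite G; F \<noteq> {}; G \<noteq> {}; \<forall>i\<in>F. \<forall>j\<in>G. i < j\<rbrakk>
      \<Longrightarrow> sum b F > 0 \<and> sum b F dvd sum b G \<and> sum b G div sum b F \<in> C m"
proof -
  obtain U :: "nat filter" where U: "U \<le> sequentially" "is_ultrafilter U" "filter_add U U \<le> U"
    by (rule idempotent_ultrafilter_nat_exists)
  have pos: "\<forall>\<^sub>F x in U. x > 0"
    using U(1) eventually_gt_at_top by (blast intro: filter_leD)
  \<comment> \<open>Pigeonhole over \<open>y\<close> yields a colour that may depend on
    \<open>x\<close>; a second pigeonhole, over \<open>x\<close>, makes it constant. Positivity and
    divisibility are carried along because \<open>div\<close> alone truncates.\<close>
  have "\<forall>\<^sub>F x in U. \<exists>m\<in>I. \<forall>\<^sub>F y in U. x > 0 \<and> x dvd y \<and> y div x \<in> C m"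
    using pos
  proof eventually_elim
    case (elim x)
    have "\<forall>\<^sub>F y in U. \<exists>m\<in>I. x > 0 \<and> x dvd y \<and> y div x \<in> C m"
      using pos idempotent_ultrafilter_nat_dvd[OF U(2,3) elim]
    proof eventually_elim
      case (elim y)
      then have "y div x \<in> {1..}"
        using \<open>x > 0\<close> by auto
      then show ?case
        using cover elim \<open>x > 0\<close> by blast
    qed
    then show ?case
      by (rule is_ultrafilter_pigeonhole[OF U(2) \<open>finite I\<close>])
  qed
  then have "\<exists>m\<in>I. \<forall>\<^sub>F x in U. \<forall>\<^sub>F y in U. x > 0 \<and> x dvd y \<and> y div x \<in> C m"
    by (rule is_ultrafilter_pigeonhole[OF U(2) \<open>finite I\<close>])
  then obtain m where m: "m \<in> I" "\<forall>\<^sub>F x in U. \<forall>\<^sub>F y in U. x > 0 \<and> x dvd y \<and> y div x \<in> C m"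
    by blast
  have "U \<noteq> bot"
    using U(2) by (simp add: is_ultrafilter_def)
  then show thesis
    using U(1,3) m(2) by (rule milliken_taylor_pairs) (rule that[OF m(1)])
qed

section \<open>Normalising by the first term\<close>

theorem theoremA:
  fixes r :: nat and C :: "nat \<Rightarrow> nat set"
  assumes "r \<ge> 1"
    and "finite_colouring r C"
  shows "\<exists>m\<in>{1..r}. \<exists>x :: nat \<Rightarrow> nat.
    (\<forall>n\<ge>1. x n \<ge> 1) \<and> strict_mono_on {1..} x \<and>
    (\<forall>(k::nat) (l::nat) (i :: nat \<Rightarrow> nat).
       1 \<le> k \<and> k < l \<and> strict_mono_on {1..l} i \<and> i ` {1..l} \<subseteq> {1..} \<longrightarrow>
       (\<Sum>j=1..k. x (i j)) \<in> C m \<and>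
       (of_nat (\<Sum>j=k+1..l. x (i j)) / of_nat (\<Sum>j=1..k. x (i j)) :: rat) \<in> of_nat ` C m)"
proof -
  have "{1..} \<subseteq> (\<Union>c\<in>{1..r}. C c)"
    using assms(2) by (simp add: finite_colouring_def)
  then obtain m and b :: "nat \<Rightarrow> nat" where "m \<in> {1..r}" and mono: "strict_mono b" and
    b: "\<And>F G. \<lbrakk>finite F; finite G; F \<noteq> {}; G \<noteq> {}; \<forall>i\<in>F. \<forall>j\<in>G. i < j\<rbrakk>
      \<Longrightarrow> sum b F > 0 \<and> sum b F dvd sum b G \<and> sum b G div sum b F \<in> C m"
    by (rule monochromatic_quotients[OF finite_atLeastAtMost]) (blast intro: that)
  \<comment> \<open>Only indices from 1 on are used, so that \<open>{0}\<close> precedes every block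
    and each sum of \<open>x\<close> becomes a quotient of sums of \<open>b\<close>.\<close>
  define x where "x n = b n div b 0" for n
  have b0: "b 0 > 0"
    using b[of "{0}" "{1}"] by simp
  have bx: "b n = b 0 * x n" if "n \<ge> 1" for n
    using b[of "{0}" "{n}"] that by (simp add: x_def)
  have sum_b: "sum b H = b 0 * sum x H" if "H \<subseteq> {1..}" for H
    unfolding sum_distrib_left using that bx by (intro sum.cong) auto
  have sum_x: "sum x H \<in> C m" if "finite H" "H \<noteq> {}" "H \<subseteq> {1..}" for H
    using b[of "{0}" H] sum_b[OF that(3)] b0 that by fastforce
  \<comment> \<open>The common factor \<open>b 0\<close> cancels, and since the quotient is exact,
    rational division agrees with \<open>div\<close>.\<close>
  have quotient: "(of_nat (sum x G) / of_nat (sum x F) :: rat) \<in> of_nat ` C m"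
    if "finite F" "finite G" "F \<noteq> {}" "G \<noteq> {}" "\<forall>i\<in>F. \<forall>j\<in>G. i < j" "F \<subseteq> {1..}" "G \<subseteq> {1..}" for F G
  proof -
    have "sum x F > 0" "sum x F dvd sum x G" "sum x G div sum x F \<in> C m"
      using b[OF that(1-5)] b0 unfolding sum_b[OF that(6)] sum_b[OF that(7)] by auto
    then show ?thesis
      by (metis imageI of_nat_of_nat_div)
  qed
  have x_mono: "strict_mono_on {1..} x"
  proof (rule strict_mono_onI)
    fix s t :: nat assume "s \<in> {1..}" "t \<in> {1..}" "s < t"
    then show "x s < x t"
      using strict_monoD[OF mono, of s t] bx[of s] bx[of t] by simp
  qed
  have x_pos: "x n \<ge> 1" if "n \<ge> 1" for n
    \<comment> \<open>The block \<open>{Suc n}\<close> only makes \<open>b\<close> applicable; what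
      matters is \<open>b n > 0\<close>.\<close>
    using b[of "{n}" "{Suc n}"] bx[OF that] by (cases "x n") auto
  show ?thesis
  proof (intro bexI[OF _ \<open>m \<in> {1..r}\<close>] exI[of _ x] conjI allI impI)
    fix k l :: nat and i :: "nat \<Rightarrow> nat"
    assume "1 \<le> k \<and> k < l \<and> strict_mono_on {1..l} i \<and> i ` {1..l} \<subseteq> {1..}"
    then have k: "1 \<le> k" "k < l" and i: "strict_mono_on {1..l} i" "i ` {1..l} \<subseteq> {1..}"
      by auto
    have reindex: "(\<Sum>j\<in>J. x (i j)) = sum x (i ` J)" if "J \<subseteq> {1..l}" for J
    proof -
      have "inj_on i J"
        using strict_mono_on_imp_inj_on[OF i(1)] that by (rule inj_on_subset)
      then show ?thesis
        by (simp add: sum.reindex)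
    qed
    have sub: "i ` {1..k} \<subseteq> {1..}" "i ` {k+1..l} \<subseteq> {1..}"
      using i(2) k by (auto simp: image_subset_iff)
    show "(\<Sum>j=1..k. x (i j)) \<in> C m"
      using sum_x[OF _ _ sub(1)] k by (simp add: reindex)
    have "\<forall>s\<in>i ` {1..k}. \<forall>t\<in>i ` {k+1..l}. s < t"
      using k by (auto intro!: strict_mono_onD[OF i(1)])
    then show "(of_nat (\<Sum>j=k+1..l. x (i j)) / of_nat (\<Sum>j=1..k. x (i j)) :: rat) \<in> of_nat ` C m"
      using quotient[OF _ _ _ _ _ sub] k by (simp add: reindex)
  qed (use x_mono x_pos in auto)
qed

end
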